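(* On the class of linear orders, (1) $\mathrm{FO}(<)$-sentences are $2^{O(m)}$-succinct in $\mathrm{FO}^3(<)$-sentences, i.e., there is a constant $c$ such that for every $\mathrm{FO}(<)$-sentence $\varphi$ there is an $\mathrm{FO}^3(<)$-sentence $\psi$ with $|\psi|\le 2^{c\cdot|\varphi|}$ and $\mathcal{A}_N\models\psi\iff\mathcal{A}_N\models\varphi$ for all $N\in\mathbb{N}$; and (2) $\mathrm{FO}^4(<)$-sentences are not $2^{o(m)}$-succinct in $\mathrm{FO}^3(<)$-sentences, i.e., there is no function $f\colon\mathbb{N}\to\mathbb{N}$ with $f(m)=2^{o(m)}$ such that for every $\mathrm{FO}^4(<)$-sentence $\varphi$ there is an $\mathrm{FO}^3(<)$-sentence $\psi$ with $|\psi|\le f(|\varphi|)$ and $\mathcal{A}_N\models\psi\iff\mathcal{A}_N\models\varphi$ for all $N\in\mathbb{N}$.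
   Context: For $N\in\mathbb{N}$, $\mathcal{A}_N$ is the linear order with universe $\{0,\dots,N\}$ and the natural order $<$; the class of linear orders is identified with $\{\mathcal{A}_N : N\in\mathbb{N}\}$. $\mathrm{FO}^k(<)$ denotes the $k$-variable fragment of first-order logic over signature $\{<\}$ (formulas using only $k$ distinct variables, which may be requantified), and $\mathrm{FO}(<)$ is full first-order logic over $\{<\}$. The size $|\varphi|$ of a formula is the number of nodes of its syntax tree (leaves are atomic formulas, inner nodes are Boolean connectives or quantifiers). *)

theory Defs
  imports Complex_Main "HOL-Library.Landau_Symbols"
begin

datatype fo =
    Less nat nat
  | Equal nat nat
  | Neg fo
  | And fo fo
  | Or fo fo
  | Exists nat fo
  | Forall nat fo

primrec fsize :: "fo \<Rightarrow> nat" where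
  "fsize (Less x y) = 1"
| "fsize (Equal x y) = 1"
| "fsize (Neg \<phi>) = fsize \<phi> + 1"
| "fsize (And \<phi> \<psi>) = fsize \<phi> + fsize \<psi> + 1"
| "fsize (Or \<phi> \<psi>) = fsize \<phi> + fsize \<psi> + 1"
| "fsize (Exists x \<phi>) = fsize \<phi> + 1"
| "fsize (Forall x \<phi>) = fsize \<phi> + 1"

primrec free_vars :: "fo \<Rightarrow> nat set" where
  "free_vars (Less x y) = {x, y}"
| "free_vars (Equal x y) = {x, y}"
| "free_vars (Neg \<phi>) = free_vars \<phi>"
| "free_vars (And \<phi> \<psi>) = free_vars \<phi> \<union> free_vars \<psi>"
| "free_vars (Or \<phi> \<psi>) = free_vars \<phi> \<union> free_vars \<psi>"
| "free_vars (Exists x \<phi>) = free_vars \<phi> - {x}"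
| "free_vars (Forall x \<phi>) = free_vars \<phi> - {x}"

text \<open>All variables, free or bound; a quantified variable counts even if it is not used
  in the scope of its quantifier.\<close>

primrec all_vars :: "fo \<Rightarrow> nat set" where
  "all_vars (Less x y) = {x, y}"
| "all_vars (Equal x y) = {x, y}"
| "all_vars (Neg \<phi>) = all_vars \<phi>"
| "all_vars (And \<phi> \<psi>) = all_vars \<phi> \<union> all_vars \<psi>"
| "all_vars (Or \<phi> \<psi>) = all_vars \<phi> \<union> all_vars \<psi>"
| "all_vars (Exists x \<phi>) = insert x (all_vars \<phi>)"
| "all_vars (Forall x \<phi>) = insert x (all_vars \<phi>)"

definition FO_sentences :: "fo set" where
  "FO_sentences = {\<phi>. free_vars \<phi> = {}}"

definition FOk_sentences :: "nat \<Rightarrow> fo set" where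
  "FOk_sentences k = {\<phi> \<in> FO_sentences. card (all_vars \<phi>) \<le> k}"

text \<open>Satisfaction in the linear order with universe \<open>{0..N}\<close> and the natural order,
  under the assignment \<open>s\<close>.\<close>

primrec sat :: "nat \<Rightarrow> (nat \<Rightarrow> nat) \<Rightarrow> fo \<Rightarrow> bool" where
  "sat N s (Less x y) \<longleftrightarrow> s x < s y"
| "sat N s (Equal x y) \<longleftrightarrow> s x = s y"
| "sat N s (Neg \<phi>) \<longleftrightarrow> \<not> sat N s \<phi>"
| "sat N s (And \<phi> \<psi>) \<longleftrightarrow> sat N s \<phi> \<and> sat N s \<psi>"
| "sat N s (Or \<phi> \<psi>) \<longleftrightarrow> sat N s \<phi> \<or> sat N s \<psi>"
| "sat N s (Exists x \<phi>) \<longleftrightarrow> (\<exists>a\<in>{0..N}. sat N (s(x := a)) \<phi>)"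
| "sat N s (Forall x \<phi>) \<longleftrightarrow> (\<forall>a\<in>{0..N}. sat N (s(x := a)) \<phi>)"

definition models :: "nat \<Rightarrow> fo \<Rightarrow> bool" where
  "models N \<phi> \<longleftrightarrow> (\<forall>s. range s \<subseteq> {0..N} \<longrightarrow> sat N s \<phi>)"

definition succinct_in :: "(nat \<Rightarrow> nat) \<Rightarrow> fo set \<Rightarrow> fo set \<Rightarrow> bool" where
  "succinct_in f L1 L2 \<longleftrightarrow>
    (\<forall>\<phi>\<in>L1. \<exists>\<psi>\<in>L2. fsize \<psi> \<le> f (fsize \<phi>) \<and> (\<forall>N. models N \<psi> \<longleftrightarrow> models N \<phi>))"

definition two_to_little_o :: "(nat \<Rightarrow> nat) \<Rightarrow> bool" where
  "two_to_little_o f \<longleftrightarrow>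
    (\<exists>g :: nat \<Rightarrow> real. g \<in> o(\<lambda>m. real m) \<and>
      (\<forall>\<^sub>F m in sequentially. real (f m) = 2 powr g m))"

end

theory Submission
  imports Defs
begin

text \<open>
  Assign to every formula a threshold for each pair of points among its variables and the two
  endpoints of the order. Two assignments, possibly in orders of different lengths, satisfy the same
  formulas if for each pair the signed distances coincide or exceed the threshold on the same side.
  An existential quantifier over \<open>x\<close> raises the threshold of \<open>u, v\<close> to that of \<open>u, x\<close> plus that of
  \<open>x, v\<close> plus one. Hence thresholds are at most exponential in the size in general, so a sentence
  of size \<open>m\<close> cannot tell apart orders longer than \<open>2 ^ m\<close> and is equivalent to a Boolean
  combination of length assertions.

  With three variables only, let \<open>c\<close> bound the sum of the thresholds of two distinct pairs of
  variables, and \<open>b\<close> the sum of a threshold to the left endpoint and one to the right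
  endpoint. A quantifier increases \<open>c\<close> by one and \<open>b\<close> by \<open>2 * c + 2\<close>, so \<open>c\<^sup>2 + b\<close> grows only
  quadratically in the size of the formula (the weight of Grohe and Schweikardt). With four
  variables, halving a distance by \<open>\<exists>z \<forall>u\<close> defines the orders of length at most \<open>2 ^ m\<close> in size
  linear in \<open>m\<close>.
\<close>

section \<open>Distance thresholds\<close>

text \<open>For \<open>d = 0\<close> this is equality of signs, which is all that an atomic formula
  can observe.\<close>

definition agree :: "nat \<Rightarrow> int \<Rightarrow> int \<Rightarrow> bool" where
  "agree d p q \<longleftrightarrow> p = q \<or> (int d < p \<and> int d < q) \<or> (p < - int d \<and> q < - int d)"

lemma agree_sym: "agree d p q \<longleftrightarrow> agree d q p"
  by (auto simp: agree_def)

lemma agree_uminus: "agree d (- p) (- q) \<longleftrightarrow> agree d p q"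
  by (auto simp: agree_def)

lemma agree_mono: "agree d p q \<Longrightarrow> e \<le> d \<Longrightarrow> agree e p q"
  by (auto simp: agree_def)

lemma agree_refl [simp]: "agree d p p"
  by (simp add: agree_def)

text \<open>The reply \<open>a'\<close> to a new point \<open>a\<close>: if \<open>a\<close> is
  within \<open>e u\<close> of some old point \<open>u\<close>, copy its offset from
  \<open>u\<close>. Otherwise \<open>a'\<close> must be farther than \<open>e u\<close> from every
  \<open>u\<close>, on the same side as \<open>a\<close>; the bound on \<open>d\<close> ensures that
  there is room.\<close>

lemma agree_extend:
  fixes p q :: "'a \<Rightarrow> int" and e :: "'a \<Rightarrow> nat" and d :: "'a \<Rightarrow> 'a \<Rightarrow> nat"
  assumes fin: "finite P"
    and ag: "\<And>u v. u \<in> P \<Longrightarrow> v \<in> P \<Longrightarrow> agree (d u v) (p u - p v) (q u - q v)"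
    and d: "\<And>u v. u \<in> P \<Longrightarrow> v \<in> P \<Longrightarrow> e u + e v + 1 \<le> d u v"
  shows "\<exists>a'. \<forall>u\<in>P. agree (e u) (a - p u) (a' - q u)"
proof (cases "\<exists>u\<in>P. \<bar>a - p u\<bar> \<le> int (e u)")
  case True
  then obtain u where u: "u \<in> P" "\<bar>a - p u\<bar> \<le> int (e u)" by blast
  have "agree (e v) (a - p v) (q u + (a - p u) - q v)" if "v \<in> P" for v
    using ag[OF u(1) that] d[OF u(1) that] u(2) unfolding agree_def by linarith
  then show ?thesis by blast
next
  case False
  define A where "A = {u \<in> P. p u < a}"
  define B where "B = {u \<in> P. a < p u}"
  have AB: "P = A \<union> B" using False by (force simp: A_def B_def)
  have finAB: "finite A" "finite B" using fin by (auto simp: A_def B_def)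
  \<comment> \<open>Here \<open>p v - p u\<close> is at least \<open>e u + e v + 2\<close>.
    Agreement at a threshold of at least \<open>e u + e v + 1\<close> transfers this bound to
    \<open>q v - q u\<close>.\<close>
  have gap: "q u + int (e u) + 1 \<le> q v - int (e v) - 1" if "u \<in> A" "v \<in> B" for u v
  proof -
    have uv: "u \<in> P" "v \<in> P" "p u < a" "a < p v" using that by (auto simp: A_def B_def)
    have "\<not> \<bar>a - p u\<bar> \<le> int (e u)" "\<not> \<bar>a - p v\<bar> \<le> int (e v)" using False uv by auto
    then show ?thesis
      using ag[OF uv(1,2)] d[OF uv(1,2)] uv(3,4) unfolding agree_def by linarith
  qed
  have "\<exists>a'. (\<forall>u\<in>A. q u + int (e u) + 1 \<le> a') \<and> (\<forall>v\<in>B. a' \<le> q v - int (e v) - 1)"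
  proof (cases "A = {}")
    case True
    \<comment> \<open>With no point to the left of \<open>a\<close> only the upper bounds constrain
      \<open>a'\<close>. Otherwise the largest lower bound serves, by \<open>gap\<close>.\<close>
    have "Min ((\<lambda>v. q v - int (e v) - 1) ` B) \<le> q v - int (e v) - 1" if "v \<in> B" for v
      using finAB that by (intro Min_le) auto
    then show ?thesis using True by blast
  next
    case ne: False
    have "Max ((\<lambda>u. q u + int (e u) + 1) ` A) \<in> (\<lambda>u. q u + int (e u) + 1) ` A"
      using ne finAB by (intro Max_in) auto
    then have "Max ((\<lambda>u. q u + int (e u) + 1) ` A) \<le> q v - int (e v) - 1" if "v \<in> B" for v
      using gap[OF _ that] by (metis (no_types, lifting) imageE)
    then show ?thesis
      using finAB by (intro exI[of _ "Max ((\<lambda>u. q u + int (e u) + 1) ` A)"]) auto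
  qed
  then obtain a' where a': "\<And>u. u \<in> A \<Longrightarrow> q u + int (e u) + 1 \<le> a'"
    "\<And>v. v \<in> B \<Longrightarrow> a' \<le> q v - int (e v) - 1" by blast
  have "agree (e u) (a - p u) (a' - q u)" if "u \<in> P" for u
  proof -
    have far: "\<not> \<bar>a - p u\<bar> \<le> int (e u)" using False that by blast
    show ?thesis
    proof (cases "u \<in> A")
      case True
      then show ?thesis using a'(1)[OF True] far by (simp add: A_def agree_def)
    next
      case False
      then have "u \<in> B" using that AB by blast
      then show ?thesis using a'(2)[of u] far by (simp add: B_def agree_def)
    qed
  qed
  then show ?thesis by blast
qed

section \<open>Thresholds of formulas and similar assignments\<close>

text \<open>The endpoints count as points that are always present. They keep replies inside the
  universe and make the length itself a distance.\<close>

datatype pt = Var nat | Lo | Hi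

primrec val :: "nat \<Rightarrow> (nat \<Rightarrow> nat) \<Rightarrow> pt \<Rightarrow> int" where
  "val N s (Var x) = int (s x)"
| "val N s Lo = 0"
| "val N s Hi = int N"

text \<open>The quantifier overwrites \<open>x\<close>, so pairs with \<open>x\<close> fall back to
  threshold 0. This reset is what keeps thresholds small when only three variables are
  available.\<close>

abbreviation (input) thr_quant :: "nat \<Rightarrow> (pt \<Rightarrow> pt \<Rightarrow> nat) \<Rightarrow> pt \<Rightarrow> pt \<Rightarrow> nat" where
  "thr_quant x t u v \<equiv> (if u = Var x \<or> v = Var x then 0 else max (t u v) (t u (Var x) + t (Var x) v + 1))"

primrec thr :: "fo \<Rightarrow> pt \<Rightarrow> pt \<Rightarrow> nat" where
  "thr (Less x y) = (\<lambda>u v. 0)"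
| "thr (Equal x y) = (\<lambda>u v. 0)"
| "thr (Neg \<phi>) = thr \<phi>"
| "thr (And \<phi> \<psi>) = (\<lambda>u v. max (thr \<phi> u v) (thr \<psi> u v))"
| "thr (Or \<phi> \<psi>) = (\<lambda>u v. max (thr \<phi> u v) (thr \<psi> u v))"
| "thr (Exists x \<phi>) = (\<lambda>u v. thr_quant x (thr \<phi>) u v)"
| "thr (Forall x \<phi>) = (\<lambda>u v. thr_quant x (thr \<phi>) u v)"

lemma thr_sym: "thr \<phi> u v = thr \<phi> v u"
  by (induction \<phi> arbitrary: u v) (simp_all, (metis add.commute)+)

definition pts :: "nat set \<Rightarrow> pt set" where
  "pts V = insert Lo (insert Hi (Var ` V))"

definition sim :: "nat set \<Rightarrow> (pt \<Rightarrow> pt \<Rightarrow> nat) \<Rightarrow> nat \<Rightarrow> (nat \<Rightarrow> nat) \<Rightarrow> nat \<Rightarrow> (nat \<Rightarrow> nat) \<Rightarrow> bool" where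
  "sim V t N s M s' \<longleftrightarrow>
    (\<forall>u\<in>pts V. \<forall>v\<in>pts V. agree (t u v) (val N s u - val N s v) (val M s' u - val M s' v))"

lemma sim_sym: "sim V t N s M s' \<longleftrightarrow> sim V t M s' N s"
  by (simp add: sim_def agree_sym)

lemma sim_mono:
  assumes "sim V t N s M s'" "\<And>u v. t' u v \<le> t u v"
  shows "sim V t' N s M s'"
  using assms unfolding sim_def by (blast intro: agree_mono)

lemma val_upd: "val N (s(x := a)) u = (if u = Var x then int a else val N s u)"
  by (cases u) auto

text \<open>One round of an Ehrenfeucht-Fraisse game: apply \<open>agree_extend\<close> to all
  points except \<open>x\<close>, with \<open>t (Var x) u\<close> as the precision required around
  \<open>u\<close>.\<close>

lemma sim_extend:
  assumes fin: "finite V" and sim: "sim V (\<lambda>u v. thr_quant x t u v) N s M s'"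
    and sym: "\<And>u v. t u v = t v u" and a: "a \<le> N"
  shows "\<exists>a'\<le>M. sim V t N (s(x := a)) M (s'(x := a'))"
proof -
  define P where "P = pts V - {Var x}"
  have ag: "agree (max (t u v) (t u (Var x) + t (Var x) v + 1))
      (val N s u - val N s v) (val M s' u - val M s' v)" if "u \<in> P" "v \<in> P" for u v
  proof -
    have "u \<in> pts V" "v \<in> pts V" "u \<noteq> Var x" "v \<noteq> Var x" using that by (auto simp: P_def)
    with sim[unfolded sim_def, rule_format, of u v] show ?thesis by simp
  qed
  have "\<exists>a'. \<forall>u\<in>P. agree (t (Var x) u) (int a - val N s u) (a' - val M s' u)"
  proof (rule agree_extend[where d = "\<lambda>u v. max (t u v) (t u (Var x) + t (Var x) v + 1)"])
    show "finite P" using fin by (simp add: P_def pts_def)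
    show "t (Var x) u + t (Var x) v + 1 \<le> max (t u v) (t u (Var x) + t (Var x) v + 1)" for u v
      using sym[of u "Var x"] by simp
  qed (rule ag)
  then obtain a' where a': "\<And>u. u \<in> P \<Longrightarrow> agree (t (Var x) u) (int a - val N s u) (a' - val M s' u)"
    by blast
  \<comment> \<open>Agreement preserves weak signs, so \<open>a - 0 \<ge> 0\<close> and
    \<open>a - N \<le> 0\<close> carry over to \<open>a'\<close> and \<open>M\<close>.\<close>
  have "Lo \<in> P" "Hi \<in> P" by (auto simp: P_def pts_def)
  from a'[OF this(1)] a'[OF this(2)] a have a'_bds: "0 \<le> a'" "a' \<le> int M"
    by (auto simp: agree_def)
  have "sim V t N (s(x := a)) M (s'(x := nat a'))"
    unfolding sim_def
  proof (intro ballI)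
    fix u v assume uv: "u \<in> pts V" "v \<in> pts V"
    consider "u = Var x" "v = Var x" | "u = Var x" "v \<in> P" | "u \<in> P" "v = Var x" | "u \<in> P" "v \<in> P"
      using uv by (auto simp: P_def)
    then show "agree (t u v) (val N (s(x := a)) u - val N (s(x := a)) v)
        (val M (s'(x := nat a')) u - val M (s'(x := nat a')) v)"
    proof cases
      case 1
      then show ?thesis by simp
    next
      case 2
      then show ?thesis using a'[of v] a'_bds by (auto simp: val_upd P_def)
    next
      case 3
      then show ?thesis
        using a'[of u] a'_bds sym[of "Var x" u]
          agree_uminus[of "t u v" "int a - val N s u" "a' - val M s' u"]
        by (auto simp: val_upd P_def)
    next
      case 4
      then show ?thesis
        using agree_mono[OF ag[OF 4] max.cobounded1] by (auto simp: val_upd P_def)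
    qed
  qed
  then show ?thesis using a'_bds by (intro exI[of _ "nat a'"]) auto
qed

text \<open>Induction on the formula: atoms need threshold 0 only, and at a quantifier
  \<open>sim_extend\<close> supplies a matching value. By symmetry of \<open>sim\<close> one
  implication suffices, hence the local claims about arbitrary \<open>N s M s'\<close>.\<close>

lemma sat_eq_if_sim:
  assumes "finite V" "all_vars \<phi> \<subseteq> V" "sim V (thr \<phi>) N s M s'"
  shows "sat N s \<phi> \<longleftrightarrow> sat M s' \<phi>"
  using assms
proof (induction \<phi> arbitrary: N s M s')
  case (Less x y)
  then have "agree 0 (val N s (Var x) - val N s (Var y)) (val M s' (Var x) - val M s' (Var y))"
    unfolding sim_def pts_def by simp
  then show ?case by (auto simp: agree_def)
next
  case (Equal x y)
  then have "agree 0 (val N s (Var x) - val N s (Var y)) (val M s' (Var x) - val M s' (Var y))"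
    unfolding sim_def pts_def by simp
  then show ?case by (auto simp: agree_def)
next
  case (Neg \<phi>)
  then show ?case by simp
next
  case (And \<phi> \<psi>)
  have "sim V (thr \<phi>) N s M s'" "sim V (thr \<psi>) N s M s'"
    by (rule sim_mono[OF And.prems(3)], simp)+
  then show ?case using And by simp
next
  case (Or \<phi> \<psi>)
  have "sim V (thr \<phi>) N s M s'" "sim V (thr \<psi>) N s M s'"
    by (rule sim_mono[OF Or.prems(3)], simp)+
  then show ?case using Or by simp
next
  case (Exists x \<phi>)
  have "sat M s' (Exists x \<phi>)" if "sat N s (Exists x \<phi>)" "sim V (thr (Exists x \<phi>)) N s M s'"
    for N s M s'
  proof -
    obtain a where a: "a \<le> N" "sat N (s(x := a)) \<phi>"
      using \<open>sat N s (Exists x \<phi>)\<close> by auto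
    obtain a' where "a' \<le> M" "sim V (thr \<phi>) N (s(x := a)) M (s'(x := a'))"
      using sim_extend[OF Exists.prems(1) \<open>sim V (thr (Exists x \<phi>)) N s M s'\<close>[unfolded thr.simps]
          thr_sym a(1)] by blast
    then show ?thesis using Exists.IH[OF Exists.prems(1)] Exists.prems(2) a(2) by auto
  qed
  then show ?case using Exists.prems(3) sim_sym by blast
next
  case (Forall x \<phi>)
  have "sat M s' (Forall x \<phi>)" if "sat N s (Forall x \<phi>)" "sim V (thr (Forall x \<phi>)) M s' N s"
    for N s M s'
  proof -
    have "sat M (s'(x := a)) \<phi>" if "a \<le> M" for a
    proof -
      obtain a' where "a' \<le> N" "sim V (thr \<phi>) M (s'(x := a)) N (s(x := a'))"
        using sim_extend[OF Forall.prems(1) \<open>sim V (thr (Forall x \<phi>)) M s' N s\<close>[unfolded thr.simps]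
            thr_sym \<open>a \<le> M\<close>] by blast
      then show ?thesis
        using Forall.IH[OF Forall.prems(1)] Forall.prems(2) \<open>sat N s (Forall x \<phi>)\<close> by auto
    qed
    then show ?thesis by simp
  qed
  then show ?case using Forall.prems(3) sim_sym by blast
qed

section \<open>From assignments to sentences\<close>

lemma finite_all_vars [simp]: "finite (all_vars \<phi>)"
  by (induction \<phi>) auto

lemma sat_cong_free_vars:
  "(\<And>x. x \<in> free_vars \<phi> \<Longrightarrow> s x = s' x) \<Longrightarrow> sat N s \<phi> \<longleftrightarrow> sat N s' \<phi>"
proof (induction \<phi> arbitrary: s s')
  case (And \<phi> \<psi>)
  have "sat N s \<phi> \<longleftrightarrow> sat N s' \<phi>" "sat N s \<psi> \<longleftrightarrow> sat N s' \<psi>"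
    by (rule And.IH; use And.prems in simp)+
  then show ?case by simp
next
  case (Or \<phi> \<psi>)
  have "sat N s \<phi> \<longleftrightarrow> sat N s' \<phi>" "sat N s \<psi> \<longleftrightarrow> sat N s' \<psi>"
    by (rule Or.IH; use Or.prems in simp)+
  then show ?case by simp
next
  case (Exists x \<phi>)
  have "sat N (s(x := a)) \<phi> \<longleftrightarrow> sat N (s'(x := a)) \<phi>" for a
    by (rule Exists.IH) (use Exists.prems in simp)
  then show ?case by simp
next
  case (Forall x \<phi>)
  have "sat N (s(x := a)) \<phi> \<longleftrightarrow> sat N (s'(x := a)) \<phi>" for a
    by (rule Forall.IH) (use Forall.prems in simp)
  then show ?case by simp
next
  case (Neg \<phi>)
  have "sat N s \<phi> \<longleftrightarrow> sat N s' \<phi>"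
    by (rule Neg.IH) (use Neg.prems in simp)
  then show ?case by simp
qed simp_all

lemma models_iff_sat: "\<phi> \<in> FO_sentences \<Longrightarrow> models N \<phi> \<longleftrightarrow> sat N s \<phi>"
proof -
  assume "\<phi> \<in> FO_sentences"
  then have "sat N s' \<phi> \<longleftrightarrow> sat N s \<phi>" for s'
    by (intro sat_cong_free_vars) (simp add: FO_sentences_def)
  moreover have "range (\<lambda>_. 0) \<subseteq> {0..N}" by auto
  ultimately show ?thesis unfolding models_def by blast
qed

text \<open>Put every variable at 0 in both orders. Then the only nonzero distances are those to
  \<open>Hi\<close>, namely \<open>N\<close> and \<open>M\<close>, and both exceed the
  threshold.\<close>

lemma models_eq_if_thr_less:
  assumes "\<phi> \<in> FO_sentences" "all_vars \<phi> \<subseteq> V" "finite V"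
    and "\<And>u. u \<in> insert Lo (Var ` V) \<Longrightarrow> thr \<phi> u Hi < N \<and> thr \<phi> u Hi < M"
  shows "models N \<phi> \<longleftrightarrow> models M \<phi>"
proof -
  have "thr \<phi> Hi u < N \<and> thr \<phi> Hi u < M" if "u \<in> insert Lo (Var ` V)" for u
    using assms(4)[OF that] thr_sym[of \<phi> Hi u] by simp
  then have "sim V (thr \<phi>) N (\<lambda>_. 0) M (\<lambda>_. 0)"
    using assms(4) by (auto simp: sim_def pts_def agree_def)
  then show ?thesis
    using sat_eq_if_sim[OF assms(3,2)] models_iff_sat[OF assms(1)] by blast
qed

section \<open>Eliminating variables\<close>

lemma fsize_pos: "1 \<le> fsize \<phi>"
  by (cases \<phi>) auto

text \<open>At a quantifier two values of at most \<open>2 ^ n - 1\<close> are added, plus one,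
  which gives at most \<open>2 ^ (n + 1) - 1\<close>.\<close>

lemma thr_less_exp: "thr \<phi> u v < 2 ^ fsize \<phi>"
proof (induction \<phi> arbitrary: u v)
  case (And \<phi> \<psi>)
  have "(2::nat) ^ fsize \<phi> \<le> 2 ^ fsize (And \<phi> \<psi>)" "(2::nat) ^ fsize \<psi> \<le> 2 ^ fsize (And \<phi> \<psi>)"
    by (rule power_increasing; simp)+
  then show ?case using And.IH(1)[of u v] And.IH(2)[of u v] unfolding thr.simps max_less_iff_conj by linarith
next
  case (Or \<phi> \<psi>)
  have "(2::nat) ^ fsize \<phi> \<le> 2 ^ fsize (Or \<phi> \<psi>)" "(2::nat) ^ fsize \<psi> \<le> 2 ^ fsize (Or \<phi> \<psi>)"
    by (rule power_increasing; simp)+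
  then show ?case using Or.IH(1)[of u v] Or.IH(2)[of u v] unfolding thr.simps max_less_iff_conj by linarith
next
  case (Exists x \<phi>)
  from this[of u v] this[of u "Var x"] this[of "Var x" v] show ?case by simp
next
  case (Forall x \<phi>)
  from this[of u v] this[of u "Var x"] this[of "Var x" v] show ?case by simp
next
  case (Neg \<phi>)
  from this[of u v] show ?case by simp
qed simp_all

lemma models_eventually_constant:
  assumes "\<phi> \<in> FO_sentences" "2 ^ fsize \<phi> \<le> N"
  shows "models N \<phi> \<longleftrightarrow> models (2 ^ fsize \<phi>) \<phi>"
  by (rule models_eq_if_thr_less[OF assms(1) order.refl finite_all_vars])
    (use thr_less_exp assms(2) in \<open>auto intro: less_le_trans\<close>)

section \<open>Defining sets of lengths with two variables\<close>

text \<open>An ascending walk of \<open>n\<close> steps from \<open>x\<close>. The two variables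
  swap roles at each step, so requantification makes two of them enough.\<close>

primrec chain_above :: "nat \<Rightarrow> nat \<Rightarrow> nat \<Rightarrow> fo" where
  "chain_above 0 x y = Equal x x"
| "chain_above (Suc n) x y = Exists y (And (Less x y) (chain_above n y x))"

lemma sat_chain_above:
  "x \<noteq> y \<Longrightarrow> s x \<le> N \<Longrightarrow> sat N s (chain_above n x y) \<longleftrightarrow> s x + n \<le> N"
proof (induction n arbitrary: x y s)
  case (Suc n)
  have "sat N (s(y := a)) (chain_above n y x) \<longleftrightarrow> a + n \<le> N" if "a \<le> N" for a
    by (subst Suc.IH) (use Suc.prems that in auto)
  then have "sat N s (chain_above (Suc n) x y) \<longleftrightarrow> (\<exists>a\<in>{0..N}. s x < a \<and> a + n \<le> N)"
    using Suc.prems by simp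
  also have "\<dots> \<longleftrightarrow> s x + Suc n \<le> N"
  proof
    assume "s x + Suc n \<le> N"
    then show "\<exists>a\<in>{0..N}. s x < a \<and> a + n \<le> N" by (intro bexI[of _ "Suc (s x)"]) auto
  qed auto
  finally show ?case .
qed simp

lemma fsize_chain_above: "fsize (chain_above n x y) = 3 * n + 1"
  by (induction n arbitrary: x y) auto

lemma all_vars_chain_above: "all_vars (chain_above n x y) \<subseteq> {x, y}"
  by (induction n arbitrary: x y) auto

lemma free_vars_chain_above: "free_vars (chain_above n x y) \<subseteq> {x}"
  by (induction n arbitrary: x y) auto

definition longer :: "nat \<Rightarrow> fo" where
  "longer n = Exists 0 (chain_above n 0 1)"

lemma sat_longer: "sat N s (longer n) \<longleftrightarrow> n \<le> N"
proof -
  have "sat N (s(0 := a)) (chain_above n 0 1) \<longleftrightarrow> a + n \<le> N" if "a \<le> N" for a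
    by (subst sat_chain_above) (use that in auto)
  then have "sat N s (longer n) \<longleftrightarrow> (\<exists>a\<le>N. a + n \<le> N)"
    by (auto simp: longer_def)
  also have "\<dots> \<longleftrightarrow> n \<le> N" by (metis add_0 le_add2 le_trans zero_le)
  finally show ?thesis .
qed

lemma fsize_longer: "fsize (longer n) = 3 * n + 2"
  by (simp add: longer_def fsize_chain_above)

lemma all_vars_longer: "all_vars (longer n) \<subseteq> {0, 1}"
  unfolding longer_def using all_vars_chain_above[of n 0 1] by simp

lemma free_vars_longer: "free_vars (longer n) = {}"
  using free_vars_chain_above[of n 0 1] by (auto simp: longer_def)

text \<open>Settle all lengths from \<open>K\<close> on by one formula, then add the lengths below
  \<open>K\<close> on which \<open>S\<close> holds one at a time, by induction on a cut-off
  \<open>n\<close>.\<close>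

lemma two_variable_definition:
  fixes S :: "nat \<Rightarrow> bool"
  assumes "\<And>N. K \<le> N \<Longrightarrow> S N \<longleftrightarrow> S K"
  obtains \<psi> where "free_vars \<psi> = {}" "all_vars \<psi> \<subseteq> {0, 1}" "\<And>N s. sat N s \<psi> \<longleftrightarrow> S N"
    "fsize \<psi> \<le> 3 * K + 3 + K * (6 * K + 10)"
proof -
  have "\<exists>\<psi>. free_vars \<psi> = {} \<and> all_vars \<psi> \<subseteq> {0, 1} \<and>
      (\<forall>N s. sat N s \<psi> \<longleftrightarrow> S N \<and> (K \<le> N \<or> N < n)) \<and>
      fsize \<psi> \<le> 3 * K + 3 + n * (6 * K + 10)" if "n \<le> K" for n
    using that
  proof (induction n)
    case 0
    show ?case
    proof (cases "S K")
      case True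
      then have "sat N s (longer K) \<longleftrightarrow> S N \<and> (K \<le> N \<or> N < 0)" for N s
        using assms[of N] by (auto simp: sat_longer)
      then show ?thesis
        using all_vars_longer[of K]
        by (intro exI[of _ "longer K"]) (simp add: fsize_longer free_vars_longer)
    next
      case False
      \<comment> \<open>\<open>Neg (longer 0)\<close> serves as falsity, since every length is at
        least 0.\<close>
      then have "sat N s (Neg (longer 0)) \<longleftrightarrow> S N \<and> (K \<le> N \<or> N < 0)" for N s
        using assms[of N] by (auto simp: sat_longer)
      then show ?thesis
        using all_vars_longer[of 0]
        by (intro exI[of _ "Neg (longer 0)"]) (simp add: fsize_longer free_vars_longer)
    qed
  next
    case (Suc n)
    then obtain \<psi> where \<psi>: "free_vars \<psi> = {}" "all_vars \<psi> \<subseteq> {0, 1}"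
      "\<And>N s. sat N s \<psi> \<longleftrightarrow> S N \<and> (K \<le> N \<or> N < n)" "fsize \<psi> \<le> 3 * K + 3 + n * (6 * K + 10)"
      by auto
    show ?case
    proof (cases "S n")
      case True
      \<comment> \<open>The new disjunct holds for length \<open>n\<close> alone and adds
        \<open>6 * n + 10\<close> nodes.\<close>
      let ?\<psi> = "Or \<psi> (And (longer n) (Neg (longer (Suc n))))"
      have "sat N s ?\<psi> \<longleftrightarrow> S N \<and> (K \<le> N \<or> N < Suc n)" for N s
        using True \<psi>(3) by (cases "N = n") (auto simp: sat_longer)
      moreover have "free_vars ?\<psi> = {}" using \<psi>(1) by (simp add: free_vars_longer)
      moreover have "all_vars ?\<psi> \<subseteq> {0, 1}" using \<psi>(2) all_vars_longer by auto
      moreover have "fsize ?\<psi> \<le> 3 * K + 3 + Suc n * (6 * K + 10)"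
        using \<psi>(4) Suc.prems by (simp add: fsize_longer)
      ultimately show ?thesis by blast
    next
      case False
      have "sat N s \<psi> \<longleftrightarrow> S N \<and> (K \<le> N \<or> N < Suc n)" for N s
        using False \<psi>(3) by (cases "N = n") auto
      moreover have "fsize \<psi> \<le> 3 * K + 3 + Suc n * (6 * K + 10)" using \<psi>(4) by simp
      ultimately show ?thesis using \<psi>(1,2) by blast
    qed
  qed
  then obtain \<psi> where \<psi>: "free_vars \<psi> = {}" "all_vars \<psi> \<subseteq> {0, 1}"
    "\<And>N s. sat N s \<psi> \<longleftrightarrow> S N \<and> (K \<le> N \<or> N < K)" "fsize \<psi> \<le> 3 * K + 3 + K * (6 * K + 10)"
    by (meson order.refl)
  have "sat N s \<psi> \<longleftrightarrow> S N" for N s using \<psi>(3) by (simp add: not_le[symmetric])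
  then show ?thesis using that \<psi>(1,2,4) by blast
qed

lemma FO_succinct_in_FO3: "succinct_in (\<lambda>m. 2 ^ (6 * m)) FO_sentences (FOk_sentences 3)"
  unfolding succinct_in_def
proof
  fix \<phi> assume \<phi>: "\<phi> \<in> FO_sentences"
  define K :: nat where "K = 2 ^ fsize \<phi>"
  obtain \<psi> where \<psi>: "free_vars \<psi> = {}" "all_vars \<psi> \<subseteq> {0, 1}"
    "\<And>N s. sat N s \<psi> \<longleftrightarrow> models N \<phi>" "fsize \<psi> \<le> 3 * K + 3 + K * (6 * K + 10)"
    by (rule two_variable_definition[of K "\<lambda>N. models N \<phi>"])
      (use models_eventually_constant[OF \<phi>, folded K_def] in blast)+
  have "card (all_vars \<psi>) \<le> 2" using card_mono[OF _ \<psi>(2)] by simp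
  then have \<psi>3: "\<psi> \<in> FOk_sentences 3" using \<psi>(1) by (simp add: FOk_sentences_def FO_sentences_def)
  have K2: "2 \<le> K" unfolding K_def using power_increasing[OF fsize_pos[of \<phi>], of "2::nat"] by simp
  \<comment> \<open>The size is quadratic in \<open>K\<close>. From \<open>K \<ge> 2\<close> the
    constant 16 is at most \<open>K ^ 4\<close>, so the total is at most \<open>K ^ 6\<close>; hence
    the exponent 6.\<close>
  have "3 * K + 3 + K * (6 * K + 10) = 6 * (K * K) + 13 * K + 3" by (simp add: algebra_simps)
  also have "\<dots> \<le> 16 * (K * K)" using mult_le_mono1[OF K2, of K] K2 by linarith
  also have "\<dots> \<le> K ^ 4 * (K * K)" using power_mono[OF K2, of 4] by (intro mult_right_mono) auto
  also have "\<dots> = 2 ^ (6 * fsize \<phi>)"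
    by (simp add: K_def power_mult[symmetric] power_add[symmetric])
  finally have "fsize \<psi> \<le> 2 ^ (6 * fsize \<phi>)" using \<psi>(4) by linarith
  moreover have "models N \<psi> \<longleftrightarrow> models N \<phi>" for N
    using \<psi>(3) models_iff_sat[of \<psi>] \<psi>3 by (simp add: FOk_sentences_def)
  ultimately show "\<exists>\<psi>\<in>FOk_sentences 3. fsize \<psi> \<le> 2 ^ (6 * fsize \<phi>) \<and>
      (\<forall>N. models N \<psi> \<longleftrightarrow> models N \<phi>)"
    using \<psi>3 by blast
qed

section \<open>Thresholds of three-variable formulas\<close>

text \<open>Two distinct pairs from a three-element set share a variable, here \<open>u\<close>. The
  endpoint bound allows \<open>u = v\<close>.\<close>

definition thr_bounds :: "nat set \<Rightarrow> (pt \<Rightarrow> pt \<Rightarrow> nat) \<Rightarrow> nat \<Rightarrow> nat \<Rightarrow> bool" where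
  "thr_bounds V t c b \<longleftrightarrow>
    (\<forall>u\<in>V. \<forall>v\<in>V. \<forall>w\<in>V. u \<noteq> v \<longrightarrow> u \<noteq> w \<longrightarrow> v \<noteq> w \<longrightarrow> t (Var u) (Var v) + t (Var u) (Var w) \<le> c) \<and>
    (\<forall>u\<in>V. \<forall>v\<in>V. t Lo (Var u) + t (Var v) Hi \<le> b) \<and> t Lo Hi \<le> b"

text \<open>Bounds are added, not maximised: a sum of two maxima may mix a threshold of
  \<open>t1\<close> with one of \<open>t2\<close>.\<close>

lemma thr_bounds_max:
  assumes "thr_bounds V t1 c1 b1" "thr_bounds V t2 c2 b2"
  shows "thr_bounds V (\<lambda>u v. max (t1 u v) (t2 u v)) (c1 + c2) (b1 + b2)"
proof -
  have sum_max: "max i k + max j l \<le> c + d" if "i + j \<le> c" "k + l \<le> d" for i j k l c d :: nat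
    using that by linarith
  have max: "max i k \<le> c + d" if "i \<le> c" "k \<le> d" for i k c d :: nat
    using that by linarith
  show ?thesis
    unfolding thr_bounds_def
    by (intro conjI ballI impI sum_max max) (use assms in \<open>simp_all add: thr_bounds_def\<close>)
qed

text \<open>Of the three variable pairs only the one avoiding \<open>x\<close> keeps a nonzero
  threshold, and its detour through \<open>x\<close> costs at most \<open>c + 1\<close>. On the
  endpoint side each of the two summands may take such a detour, adding at most \<open>c + 1\<close>
  to an old endpoint threshold.\<close>

lemma thr_bounds_quant:
  assumes V: "card V = 3" and x: "x \<in> V" and t: "thr_bounds V t c b" and sym: "\<And>u v. t u v = t v u"
  shows "thr_bounds V (\<lambda>u v. thr_quant x t u v) (c + 1) (b + 2 * c + 2)"
proof -
  let ?t = "\<lambda>u v. thr_quant x t u v"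
  have c: "t (Var u) (Var v) + t (Var u) (Var w) \<le> c"
    if "u \<in> V" "v \<in> V" "w \<in> V" "u \<noteq> v" "u \<noteq> w" "v \<noteq> w" for u v w
    using t that by (simp add: thr_bounds_def)
  have b: "t Lo (Var u) + t (Var v) Hi \<le> b" if "u \<in> V" "v \<in> V" for u v
    using t that by (simp add: thr_bounds_def)
  have b': "t Lo Hi \<le> b" using t by (simp add: thr_bounds_def)
  have fin: "finite V" using V by (metis card.infinite zero_neq_numeral)
  have third: "\<exists>w\<in>V. w \<noteq> u \<and> w \<noteq> v" for u v
  proof (rule ccontr)
    assume "\<not> ?thesis"
    then have "V \<subseteq> {u, v}" by blast
    then have "card V \<le> card {u, v}" by (intro card_mono) auto
    also have "\<dots> \<le> 2" by (simp add: card_insert_if)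
    finally show False using V by simp
  qed
  \<comment> \<open>The bound \<open>c\<close> concerns three distinct variables, so a third one is
    supplied first.\<close>
  have single: "t (Var u) (Var v) \<le> c" if "u \<in> V" "v \<in> V" "u \<noteq> v" for u v
    using third[of u v] c[of u v] that by force
  have quant: "?t (Var u) (Var w) \<le> c + 1" if "u \<in> V" "w \<in> V" "u \<noteq> w" for u w
    using single[OF that] c[of x u w] sym[of "Var u" "Var x"] that x by auto
  have only_three: "x = u \<or> x = v \<or> x = w"
    if uvw: "u \<in> V" "v \<in> V" "w \<in> V" "u \<noteq> v" "u \<noteq> w" "v \<noteq> w" for u v w
  proof -
    have "{u, v, w} = V" using uvw V fin by (intro card_subset_eq) auto
    then show ?thesis using x by blast
  qed
  have "?t (Var u) (Var v) + ?t (Var u) (Var w) \<le> c + 1"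
    if "u \<in> V" "v \<in> V" "w \<in> V" "u \<noteq> v" "u \<noteq> w" "v \<noteq> w" for u v w
    using only_three[OF that] quant[of u v] quant[of u w] that by auto
  moreover have "?t Lo (Var u) + ?t (Var v) Hi \<le> b + 2 * c + 2" if uv: "u \<in> V" "v \<in> V" for u v
  proof -
    have lo: "?t Lo (Var u) \<le> t Lo (Var u) \<or> ?t Lo (Var u) \<le> t Lo (Var x) + c + 1"
      using single[of x u] x uv by (auto simp: max_def)
    have hi: "?t (Var v) Hi \<le> t (Var v) Hi \<or> ?t (Var v) Hi \<le> c + t (Var x) Hi + 1"
      using single[of v x] x uv by (auto simp: max_def)
    show ?thesis
      using lo hi b[OF uv] b[OF x uv(2)] b[OF uv(1) x] b[OF x x] by linarith
  qed
  moreover have "?t Lo Hi \<le> b + 2 * c + 2" using b' b[OF x x] by auto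
  ultimately show ?thesis unfolding thr_bounds_def by blast
qed

text \<open>The left side grows by \<open>4 * c + 3\<close>, the right side by
  \<open>8 * s + 4\<close>, and \<open>c \<le> 2 * s\<close>. The factor 2 is chosen to make this
  fit.\<close>

lemma weight_quant:
  fixes c b s :: nat
  assumes "c\<^sup>2 + b \<le> (2 * s)\<^sup>2"
  shows "(c + 1)\<^sup>2 + (b + 2 * c + 2) \<le> (2 * (s + 1))\<^sup>2"
proof -
  have "c\<^sup>2 \<le> (2 * s)\<^sup>2" using assms by linarith
  then have "c \<le> 2 * s" by (simp only: power2_nat_le_eq_le)
  then show ?thesis using assms by (simp add: power2_eq_square algebra_simps)
qed

text \<open>The cross term \<open>2 * c1 * c2\<close> is absorbed by the cross term
  \<open>8 * s1 * s2\<close> of the square on the right.\<close>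

lemma weight_binary:
  fixes c1 b1 s1 c2 b2 s2 :: nat
  assumes "c1\<^sup>2 + b1 \<le> (2 * s1)\<^sup>2" "c2\<^sup>2 + b2 \<le> (2 * s2)\<^sup>2"
  shows "(c1 + c2)\<^sup>2 + (b1 + b2) \<le> (2 * (s1 + s2 + 1))\<^sup>2"
proof -
  have "c1\<^sup>2 \<le> (2 * s1)\<^sup>2" "c2\<^sup>2 \<le> (2 * s2)\<^sup>2" using assms by linarith+
  then have "c1 \<le> 2 * s1" "c2 \<le> 2 * s2" by (simp_all only: power2_nat_le_eq_le)
  then have "c1 * c2 \<le> (2 * s1) * (2 * s2)" by (rule mult_le_mono)
  then show ?thesis using assms by (simp add: power2_eq_square algebra_simps)
qed

lemma thr_bounds_fsize:
  assumes V: "card V = 3" and "all_vars \<phi> \<subseteq> V"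
  shows "\<exists>c b. thr_bounds V (thr \<phi>) c b \<and> c\<^sup>2 + b \<le> (2 * fsize \<phi>)\<^sup>2"
  using assms(2)
proof (induction \<phi>)
  case (Less x y)
  show ?case by (intro exI[of _ 0]) (simp add: thr_bounds_def)
next
  case (Equal x y)
  show ?case by (intro exI[of _ 0]) (simp add: thr_bounds_def)
next
  case (Neg \<phi>)
  then obtain c b where "thr_bounds V (thr \<phi>) c b" "c\<^sup>2 + b \<le> (2 * fsize \<phi>)\<^sup>2" by auto
  moreover have "(2 * fsize \<phi>)\<^sup>2 \<le> (2 * fsize (Neg \<phi>))\<^sup>2" by (simp only: power2_nat_le_eq_le) simp
  ultimately show ?case by (metis order.trans thr.simps(3))
next
  case (And \<phi> \<psi>)
  then obtain c1 b1 c2 b2 where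
    "thr_bounds V (thr \<phi>) c1 b1" "c1\<^sup>2 + b1 \<le> (2 * fsize \<phi>)\<^sup>2"
    "thr_bounds V (thr \<psi>) c2 b2" "c2\<^sup>2 + b2 \<le> (2 * fsize \<psi>)\<^sup>2" by auto
  then show ?case unfolding thr.simps fsize.simps by (blast intro: thr_bounds_max weight_binary)
next
  case (Or \<phi> \<psi>)
  then obtain c1 b1 c2 b2 where
    "thr_bounds V (thr \<phi>) c1 b1" "c1\<^sup>2 + b1 \<le> (2 * fsize \<phi>)\<^sup>2"
    "thr_bounds V (thr \<psi>) c2 b2" "c2\<^sup>2 + b2 \<le> (2 * fsize \<psi>)\<^sup>2" by auto
  then show ?case unfolding thr.simps fsize.simps by (blast intro: thr_bounds_max weight_binary)
next
  case (Exists x \<phi>)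
  then obtain c b where "thr_bounds V (thr \<phi>) c b" "c\<^sup>2 + b \<le> (2 * fsize \<phi>)\<^sup>2" by auto
  then have "thr_bounds V (thr (Exists x \<phi>)) (c + 1) (b + 2 * c + 2)"
    "(c + 1)\<^sup>2 + (b + 2 * c + 2) \<le> (2 * fsize (Exists x \<phi>))\<^sup>2"
    using thr_bounds_quant[OF V, of x "thr \<phi>" c b] weight_quant[of c b] Exists.prems thr_sym
    unfolding thr.simps fsize.simps all_vars.simps by (blast, blast)
  then show ?case by blast
next
  case (Forall x \<phi>)
  then obtain c b where "thr_bounds V (thr \<phi>) c b" "c\<^sup>2 + b \<le> (2 * fsize \<phi>)\<^sup>2" by auto
  then have "thr_bounds V (thr (Forall x \<phi>)) (c + 1) (b + 2 * c + 2)"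
    "(c + 1)\<^sup>2 + (b + 2 * c + 2) \<le> (2 * fsize (Forall x \<phi>))\<^sup>2"
    using thr_bounds_quant[OF V, of x "thr \<phi>" c b] weight_quant[of c b] Forall.prems thr_sym
    unfolding thr.simps fsize.simps all_vars.simps by (blast, blast)
  then show ?case by blast
qed

text \<open>Thresholds to the right endpoint are at most \<open>b\<close>, hence at most the
  quadratic weight, so both lengths lie beyond them.\<close>

lemma FO3_models_eq:
  assumes \<psi>: "\<psi> \<in> FOk_sentences 3" and "(2 * fsize \<psi>)\<^sup>2 < N" "(2 * fsize \<psi>)\<^sup>2 < M"
  shows "models N \<psi> \<longleftrightarrow> models M \<psi>"
proof -
  have "card (all_vars \<psi>) \<le> 3" using \<psi> by (simp add: FOk_sentences_def)
  \<comment> \<open>Pad with fresh variables to exactly three, as the threshold bounds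
    require.\<close>
  moreover obtain W where W: "finite W" "card W = 3 - card (all_vars \<psi>)" "W \<subseteq> - all_vars \<psi>"
    using infinite_arbitrarily_large[of "- all_vars \<psi>" "3 - card (all_vars \<psi>)"]
    by (auto simp: Compl_eq_Diff_UNIV)
  moreover define V where "V = all_vars \<psi> \<union> W"
  moreover have "all_vars \<psi> \<inter> W = {}" using W(3) by blast
  ultimately have V: "finite V" "card V = 3" "all_vars \<psi> \<subseteq> V"
    by (auto simp: card_Un_disjoint)
  obtain c b where cb: "thr_bounds V (thr \<psi>) c b" "c\<^sup>2 + b \<le> (2 * fsize \<psi>)\<^sup>2"
    using thr_bounds_fsize[OF V(2,3)] by blast
  show ?thesis
  proof (rule models_eq_if_thr_less[OF _ V(3,1)])
    show "\<psi> \<in> FO_sentences" using \<psi> by (simp add: FOk_sentences_def)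
    fix u assume "u \<in> insert Lo (Var ` V)"
    then have "thr \<psi> u Hi \<le> b" using cb(1) unfolding thr_bounds_def by (blast dest: add_leD2)
    then show "thr \<psi> u Hi < N \<and> thr \<psi> u Hi < M" using cb(2) assms(2,3) by linarith
  qed
qed

section \<open>Short four-variable sentences for long orders\<close>

text \<open>Distance at most \<open>2 ^ m\<close>: \<open>z\<close> is a midpoint and
  \<open>u\<close> ranges over both ends, so the recursive formula occurs only once and the size
  stays linear. Below, \<open>x\<close> and \<open>y\<close> are recycled as auxiliary
  variables.\<close>

primrec near :: "nat \<Rightarrow> nat \<Rightarrow> nat \<Rightarrow> nat \<Rightarrow> nat \<Rightarrow> fo" where
  "near 0 x y z u = Neg (Exists z (Or (And (Less x z) (Less z y)) (And (Less y z) (Less z x))))"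
| "near (Suc m) x y z u = Exists z (Forall u (Or (Neg (Or (Equal u x) (Equal u y))) (near m z u x y)))"

text \<open>The rounded midpoint works because half of a distance of at most \<open>2 * r\<close>,
  rounded up, is still at most \<open>r\<close>. The converse is the triangle inequality.\<close>

lemma midpoint_exists:
  fixes a b N r :: nat
  assumes "a \<le> N" "b \<le> N"
  shows "(\<exists>c\<le>N. \<bar>int c - int a\<bar> \<le> int r \<and> \<bar>int c - int b\<bar> \<le> int r) \<longleftrightarrow> \<bar>int a - int b\<bar> \<le> 2 * int r"
proof
  assume "\<bar>int a - int b\<bar> \<le> 2 * int r"
  then have "\<bar>int ((a + b) div 2) - int a\<bar> \<le> int r \<and> \<bar>int ((a + b) div 2) - int b\<bar> \<le> int r"
    by linarith
  moreover have "(a + b) div 2 \<le> N" using assms by linarith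
  ultimately show "\<exists>c\<le>N. \<bar>int c - int a\<bar> \<le> int r \<and> \<bar>int c - int b\<bar> \<le> int r" by blast
next
  assume "\<exists>c\<le>N. \<bar>int c - int a\<bar> \<le> int r \<and> \<bar>int c - int b\<bar> \<le> int r"
  then obtain c where "\<bar>int c - int a\<bar> \<le> int r" "\<bar>int c - int b\<bar> \<le> int r" by blast
  then show "\<bar>int a - int b\<bar> \<le> 2 * int r" by linarith
qed

lemma sat_near:
  assumes "distinct [x, y, z, u]" "s x \<le> N" "s y \<le> N"
  shows "sat N s (near m x y z u) \<longleftrightarrow> \<bar>int (s x) - int (s y)\<bar> \<le> 2 ^ m"
  using assms
proof (induction m arbitrary: x y z u s)
  case 0
  have "sat N s (near 0 x y z u) \<longleftrightarrow>
      \<not> (\<exists>c\<in>{0..N}. s x < c \<and> c < s y \<or> s y < c \<and> c < s x)"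
    using 0 by simp
  also have "\<dots> \<longleftrightarrow> \<bar>int (s x) - int (s y)\<bar> \<le> 1"
  proof
    assume none: "\<not> (\<exists>c\<in>{0..N}. s x < c \<and> c < s y \<or> s y < c \<and> c < s x)"
    have "\<not> Suc (s x) < s y"
    proof
      assume "Suc (s x) < s y"
      with none 0 show False by (auto dest!: bspec[of _ _ "Suc (s x)"])
    qed
    moreover have "\<not> Suc (s y) < s x"
    proof
      assume "Suc (s y) < s x"
      with none 0 show False by (auto dest!: bspec[of _ _ "Suc (s y)"])
    qed
    ultimately show "\<bar>int (s x) - int (s y)\<bar> \<le> 1" by linarith
  qed auto
  finally show ?case by simp
next
  case (Suc m)
  have IH: "sat N (s(z := c, u := d)) (near m z u x y) \<longleftrightarrow> \<bar>int c - int d\<bar> \<le> 2 ^ m"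
    if "c \<le> N" "d \<le> N" for c d
    by (subst Suc.IH) (use Suc.prems that in auto)
  have "sat N s (near (Suc m) x y z u) \<longleftrightarrow> (\<exists>c\<in>{0..N}. \<forall>d\<in>{0..N}.
      \<not> (d = s x \<or> d = s y) \<or> sat N (s(z := c, u := d)) (near m z u x y))"
    using Suc.prems(1) by simp
  also have "\<dots> \<longleftrightarrow> (\<exists>c\<in>{0..N}. \<forall>d\<in>{0..N}. \<not> (d = s x \<or> d = s y) \<or> \<bar>int c - int d\<bar> \<le> 2 ^ m)"
    by (intro bex_cong ball_cong refl) (simp add: IH)
  also have "\<dots> \<longleftrightarrow> (\<exists>c\<le>N. \<bar>int c - int (s x)\<bar> \<le> int (2 ^ m) \<and> \<bar>int c - int (s y)\<bar> \<le> int (2 ^ m))"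
  proof -
    \<comment> \<open>The guard leaves only \<open>d = s x\<close> and \<open>d = s y\<close>, and
      both values lie in the universe.\<close>
    have "(\<forall>d\<in>{0..N}. \<not> (d = s x \<or> d = s y) \<or> \<bar>int c - int d\<bar> \<le> 2 ^ m) \<longleftrightarrow>
        \<bar>int c - int (s x)\<bar> \<le> int (2 ^ m) \<and> \<bar>int c - int (s y)\<bar> \<le> int (2 ^ m)" for c
      using Suc.prems(2,3) by (simp only: of_nat_power of_nat_numeral) force
    then show ?thesis by (simp add: Bex_def)
  qed
  also have "\<dots> \<longleftrightarrow> \<bar>int (s x) - int (s y)\<bar> \<le> 2 ^ Suc m"
    using midpoint_exists[OF Suc.prems(2,3), of "2 ^ m"] by simp
  finally show ?case .
qed

lemma fsize_near: "fsize (near m x y z u) = 7 * m + 9"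
  by (induction m arbitrary: x y z u) auto

lemma free_vars_near: "free_vars (near m x y z u) \<subseteq> {x, y}"
proof (induction m arbitrary: x y z u)
  case (Suc m)
  from this[of z u x y] show ?case by auto
qed auto

lemma all_vars_near: "all_vars (near m x y z u) \<subseteq> {x, y, z, u}"
proof (induction m arbitrary: x y z u)
  case (Suc m)
  from this[of z u x y] show ?case by auto
qed auto

definition at_most_exp :: "nat \<Rightarrow> fo" where
  "at_most_exp m = Forall 0 (Forall 1 (near m 0 1 2 3))"

lemma at_most_exp_FO4: "at_most_exp m \<in> FOk_sentences 4"
proof -
  have "all_vars (at_most_exp m) \<subseteq> {0, 1, 2, 3}"
    using all_vars_near[of m 0 1 2 3] by (auto simp: at_most_exp_def)
  then have "card (all_vars (at_most_exp m)) \<le> card {0, 1, 2, 3 :: nat}" by (intro card_mono) auto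
  moreover have "free_vars (at_most_exp m) = {}"
    using free_vars_near[of m 0 1 2 3] by (auto simp: at_most_exp_def)
  ultimately show ?thesis by (simp add: FOk_sentences_def FO_sentences_def)
qed

lemma models_at_most_exp: "models N (at_most_exp m) \<longleftrightarrow> N \<le> 2 ^ m"
proof -
  have "at_most_exp m \<in> FO_sentences" using at_most_exp_FO4 by (simp add: FOk_sentences_def)
  then have "models N (at_most_exp m) \<longleftrightarrow> sat N (\<lambda>_. 0) (at_most_exp m)" by (rule models_iff_sat)
  also have "\<dots> \<longleftrightarrow> (\<forall>a\<le>N. \<forall>b\<le>N. \<bar>int a - int b\<bar> \<le> 2 ^ m)"
  proof -
    have "sat N ((\<lambda>_. 0)(0 := a, 1 := b)) (near m 0 1 2 3) \<longleftrightarrow> \<bar>int a - int b\<bar> \<le> 2 ^ m"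
      if "a \<le> N" "b \<le> N" for a b
      by (subst sat_near) (use that in auto)
    then show ?thesis by (auto simp: at_most_exp_def)
  qed
  also have "\<dots> \<longleftrightarrow> int N \<le> 2 ^ m"
  proof
    assume "\<forall>a\<le>N. \<forall>b\<le>N. \<bar>int a - int b\<bar> \<le> 2 ^ m"
    \<comment> \<open>The two endpoints realise the largest distance.\<close>
    then have "\<bar>int N - int 0\<bar> \<le> 2 ^ m" by blast
    then show "int N \<le> 2 ^ m" by simp
  qed (auto intro: order.trans[of _ "int N"])
  also have "\<dots> \<longleftrightarrow> N \<le> 2 ^ m" by (metis of_nat_le_iff of_nat_numeral of_nat_power)
  finally show ?thesis .
qed

lemma fsize_at_most_exp: "fsize (at_most_exp m) = 7 * m + 11"
  by (simp add: at_most_exp_def fsize_near)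

section \<open>The exponential gap between four and three variables\<close>

text \<open>Otherwise \<open>\<psi>\<close> could not separate the lengths \<open>2 ^ m\<close> and
  \<open>2 ^ m + 1\<close>, which \<open>at_most_exp m\<close> does.\<close>

lemma FO3_size_lower_bound:
  assumes "\<psi> \<in> FOk_sentences 3" "\<And>N. models N \<psi> \<longleftrightarrow> models N (at_most_exp m)"
  shows "2 ^ m \<le> (2 * fsize \<psi>)\<^sup>2"
proof (rule ccontr)
  assume "\<not> ?thesis"
  then have "models (2 ^ m) \<psi> \<longleftrightarrow> models (2 ^ m + 1) \<psi>"
    by (intro FO3_models_eq[OF assms(1)]) auto
  then show False using assms(2) by (simp add: models_at_most_exp)
qed

text \<open>The sentences \<open>at_most_exp m\<close> have size linear in \<open>m\<close> but need
  about \<open>2 powr (m / 2)\<close> nodes with three variables, more than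
  \<open>2 powr g k\<close> permits for sublinear \<open>g\<close>.\<close>

lemma FO4_not_succinct_in_FO3:
  assumes "two_to_little_o f"
  shows "\<not> succinct_in f (FOk_sentences 4) (FOk_sentences 3)"
proof
  assume succ: "succinct_in f (FOk_sentences 4) (FOk_sentences 3)"
  obtain g where g: "g \<in> o(\<lambda>m. real m)" "\<forall>\<^sub>F m in sequentially. real (f m) = 2 powr g m"
    using assms unfolding two_to_little_o_def by blast
  have "\<forall>\<^sub>F k in sequentially. norm (g k) \<le> 1 / 28 * norm (real k)"
    by (rule landau_o.smallD[OF g(1)]) simp
  with g(2) have "\<forall>\<^sub>F k in sequentially. real (f k) = 2 powr g k \<and> norm (g k) \<le> 1 / 28 * norm (real k)"
    by (rule eventually_conj)
  then obtain k0 where k0: "\<And>k. k0 \<le> k \<Longrightarrow> real (f k) = 2 powr g k \<and> norm (g k) \<le> 1 / 28 * norm (real k)"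
    unfolding eventually_sequentially by blast
  \<comment> \<open>With \<open>k = 7 * m + 11\<close> the exponent \<open>k / 28\<close> doubles
    twice to give \<open>m \<le> 2 + k / 14 = m / 2 + 39 / 14\<close>. This fails for every
    \<open>m \<ge> 6\<close>.\<close>
  define m where "m = k0 + 6"
  obtain \<psi> where \<psi>: "\<psi> \<in> FOk_sentences 3" "fsize \<psi> \<le> f (7 * m + 11)"
    "\<And>N. models N \<psi> \<longleftrightarrow> models N (at_most_exp m)"
    using succ[unfolded succinct_in_def, rule_format, OF at_most_exp_FO4[of m]]
    unfolding fsize_at_most_exp by blast
  define k where "k = 7 * m + 11"
  have "k0 \<le> k" by (simp add: k_def m_def)
  from k0[OF this] have fk: "real (f k) = 2 powr g k" and "\<bar>g k\<bar> \<le> real k / 28" by simp_all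
  then have gk: "g k \<le> real k / 28" by linarith
  have "2 powr real m = real (2 ^ m)" by (simp add: powr_realpow)
  also have "\<dots> \<le> real ((2 * fsize \<psi>)\<^sup>2)"
    using FO3_size_lower_bound[OF \<psi>(1,3)] by (rule of_nat_mono)
  also have "\<dots> = (2 * real (fsize \<psi>))\<^sup>2" by simp
  also have "\<dots> \<le> (2 * 2 powr (real k / 28))\<^sup>2"
  proof -
    have "real (fsize \<psi>) \<le> real (f k)" using \<psi>(2) unfolding k_def by (rule of_nat_mono)
    also have "\<dots> \<le> 2 powr (real k / 28)" unfolding fk using gk by (rule powr_mono) simp
    finally have "2 * real (fsize \<psi>) \<le> 2 * 2 powr (real k / 28)" by (rule mult_left_mono) simp
    then show ?thesis by (rule power_mono) simp
  qed
  also have "\<dots> = (2 powr (1 + real k / 28))\<^sup>2"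
    by (simp add: powr_add)
  also have "\<dots> = 2 powr ((1 + real k / 28) + (1 + real k / 28))"
    by (simp only: powr_add power2_eq_square)
  finally have "real m \<le> (1 + real k / 28) + (1 + real k / 28)"
    by (subst (asm) powr_le_cancel_iff) simp_all
  then show False by (simp add: k_def m_def)
qed

theorem theorem5p3:
  "(\<exists>c :: nat. succinct_in (\<lambda>m. 2 ^ (c * m)) FO_sentences (FOk_sentences 3)) \<and>
   \<not> (\<exists>f :: nat \<Rightarrow> nat. two_to_little_o f \<and>
        succinct_in f (FOk_sentences 4) (FOk_sentences 3))"
  using FO_succinct_in_FO3 FO4_not_succinct_in_FO3 by blast

end
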